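(* Let $0<\alpha\le 1$. For every $f(z)=z+\sum_{n=2}^{\infty}a_nz^n$ in $\mathcal{S}_{ex}^{\ast}$ (the class with parameter $\alpha$), the third-order Hermitian--Toeplitz determinant $T_{3,1}(f)$ satisfies \[ \mathcal{B}_L(\alpha)\le T_{3,1}(f)\le 1, \] where \[ \mathcal{B}_L(\alpha)= \begin{cases} 1-2\alpha^2+\dfrac{15\alpha^4}{16}, & 0<\alpha<\alpha_H,\\[6pt] 1-\dfrac{\alpha^2}{4}-\dfrac{\alpha^2(\alpha+6)^2}{4(15\alpha^2+4\alpha-4)}, & \alpha_H\le\alpha\le1, \end{cases} \qquad \alpha_H:=\frac{-1+\sqrt{241}}{15}\approx0.9683. \] Both bounds are sharp for all $\alpha\in(0,1]$: for each such $\alpha$ there is a function in $\mathcal{S}_{ex}^{\ast}$ with $T_{3,1}(f)=\mathcal{B}_L(\alpha)$ and a function in $\mathcal{S}_{ex}^{\ast}$ with $T_{3,1}(f)=1$.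
   Context: Let $\mathbb{D}=\{z\in\mathbb{C}:|z|<1\}$. Let $\mathcal{A}$ be the class of analytic functions $f$ in $\mathbb{D}$ of the form $f(z)=z+\sum_{n=2}^{\infty}a_nz^n$ (so $a_1=1$). For analytic $F,G$ in $\mathbb{D}$, $F\prec G$ ($F$ is subordinate to $G$) means that there is an analytic $\omega:\mathbb{D}\to\mathbb{D}$ with $\omega(0)=0$ and $F(z)=G(\omega(z))$ for $z\in\mathbb{D}$. For $0<\alpha\le1$, $\mathcal{S}_{ex}^{\ast}$ is the class of all $f\in\mathcal{A}$ such that $\frac{zf'(z)}{f(z)}\prec e^{\alpha z}$ in $\mathbb{D}$ (the quotient being given the value $1$ at $z=0$). The third-order Hermitian--Toeplitz determinant is \[ T_{3,1}(f)=\begin{vmatrix}1&a_2&a_3\\ \overline{a_2}&1&a_2\\ \overline{a_3}&\overline{a_2}&1\end{vmatrix}=2\Re\left(a_2^2\overline{a_3}\right)-2|a_2|^2-|a_3|^2+1. \] *)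

theory Defs
  imports "HOL-Complex_Analysis.Complex_Analysis"
begin

abbreviation unit_disc :: "complex set" ("\<D>") where
  "\<D> \<equiv> ball 0 1"

text \<open>The Taylor coefficient \<open>a\<^sub>n\<close> of \<open>f\<close> at the origin.\<close>

definition taylor_coeff :: "(complex \<Rightarrow> complex) \<Rightarrow> nat \<Rightarrow> complex" where
  "taylor_coeff f n = fps_nth (fps_expansion f 0) n"

text \<open>Functions on the disc are represented by total functions; their values outside
  \<open>\<D>\<close> are irrelevant. The summation index is shifted by \<open>2\<close>.\<close>

definition class_A :: "(complex \<Rightarrow> complex) set" where
  "class_A = {f. f holomorphic_on \<D> \<and>
     (\<forall>z\<in>\<D>. (\<lambda>n. taylor_coeff f (n + 2) * z ^ (n + 2)) sums (f z - z))}"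

lemma class_A_iff:
  "f \<in> class_A \<longleftrightarrow> f holomorphic_on \<D> \<and> f 0 = 0 \<and> deriv f 0 = 1"
proof (cases "f holomorphic_on \<D>")
  case True
  have tc: "taylor_coeff f 0 = f 0" "taylor_coeff f 1 = deriv f 0"
    by (simp_all add: taylor_coeff_def fps_expansion_def)
  have S: "(\<lambda>n. taylor_coeff f (n + 2) * z ^ (n + 2)) sums (f z - f 0 - deriv f 0 * z)"
    if "z \<in> \<D>" for z
  proof -
    have "(\<lambda>n. taylor_coeff f n * z ^ n) sums f z"
      using holomorphic_power_series[OF True that] by (simp add: taylor_coeff_def fps_expansion_def)
    from sums_split_initial_segment[OF this, of 2] show ?thesis
      using tc by (simp add: numeral_2_eq_2 algebra_simps)
  qed
  show ?thesis
  proof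
    assume "f \<in> class_A"
    then have eq: "f z - z = f z - f 0 - deriv f 0 * z" if "z \<in> \<D>" for z
      using S[OF that] that unfolding class_A_def by (blast dest: sums_unique2)
    have "f 0 = 0" using eq[of 0] by simp
    moreover have "deriv f 0 = 1" using eq[of "1/2"] \<open>f 0 = 0\<close> by (simp add: norm_divide)
    ultimately show "f holomorphic_on \<D> \<and> f 0 = 0 \<and> deriv f 0 = 1" using True by simp
  next
    assume "f holomorphic_on \<D> \<and> f 0 = 0 \<and> deriv f 0 = 1"
    then show "f \<in> class_A" using S unfolding class_A_def by auto
  qed
qed (simp add: class_A_def)

definition subordinate :: "(complex \<Rightarrow> complex) \<Rightarrow> (complex \<Rightarrow> complex) \<Rightarrow> bool"
    (infix "\<prec>\<^sub>s" 50) where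
  "F \<prec>\<^sub>s G \<longleftrightarrow> F holomorphic_on \<D> \<and> G holomorphic_on \<D> \<and>
     (\<exists>\<omega>. \<omega> holomorphic_on \<D> \<and> \<omega> ` \<D> \<subseteq> \<D> \<and> \<omega> 0 = 0 \<and> (\<forall>z\<in>\<D>. F z = G (\<omega> z)))"

text \<open>The quotient takes the HOL value \<open>x / 0 = 0\<close> where \<open>f\<close> vanishes. Since \<open>exp\<close> has no
  zeros, the subordination below therefore excludes zeros of \<open>f\<close> in \<open>\<D> - {0}\<close>, just as
  poles of the quotient do in the mathematical definition.\<close>

definition S_ex :: "real \<Rightarrow> (complex \<Rightarrow> complex) set" where
  "S_ex \<alpha> = {f \<in> class_A.
     (\<lambda>z. if z = 0 then 1 else z * deriv f z / f z) \<prec>\<^sub>s (\<lambda>z. exp (of_real \<alpha> * z))}"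

definition toeplitz_3_1 :: "(complex \<Rightarrow> complex) \<Rightarrow> complex^3^3" where
  "toeplitz_3_1 f = (let a2 = taylor_coeff f 2; a3 = taylor_coeff f 3 in
     vector [vector [1, a2, a3],
             vector [cnj a2, 1, a2],
             vector [cnj a3, cnj a2, 1]])"

text \<open>The determinant of a Hermitian matrix is real, so \<open>Re\<close> only adjusts the type.\<close>

definition T_3_1 :: "(complex \<Rightarrow> complex) \<Rightarrow> real" where
  "T_3_1 f = Re (det (toeplitz_3_1 f))"

lemma det_toeplitz_3_1:
  "det (toeplitz_3_1 f) = complex_of_real
     (2 * Re ((taylor_coeff f 2)\<^sup>2 * cnj (taylor_coeff f 3))
        - 2 * (cmod (taylor_coeff f 2))\<^sup>2 - (cmod (taylor_coeff f 3))\<^sup>2 + 1)"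
  unfolding cmod_power2
  by (simp add: toeplitz_3_1_def Let_def det_3 vector_3 complex_eq_iff power2_eq_square
      algebra_simps)

lemma T_3_1_eq:
  "T_3_1 f = 2 * Re ((taylor_coeff f 2)\<^sup>2 * cnj (taylor_coeff f 3))
     - 2 * (cmod (taylor_coeff f 2))\<^sup>2 - (cmod (taylor_coeff f 3))\<^sup>2 + 1"
  unfolding T_3_1_def det_toeplitz_3_1 by simp

lemma of_real_T_3_1: "complex_of_real (T_3_1 f) = det (toeplitz_3_1 f)"
  unfolding T_3_1_eq det_toeplitz_3_1 ..

definition alpha_H :: real where
  "alpha_H = (- 1 + sqrt 241) / 15"

text \<open>Only used for \<open>0 < \<alpha> \<le> 1\<close>.\<close>

definition B_L :: "real \<Rightarrow> real" where
  "B_L \<alpha> = (if \<alpha> < alpha_H then 1 - 2 * \<alpha>\<^sup>2 + 15 * \<alpha> ^ 4 / 16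
     else 1 - \<alpha>\<^sup>2 / 4 - \<alpha>\<^sup>2 * (\<alpha> + 6)\<^sup>2 / (4 * (15 * \<alpha>\<^sup>2 + 4 * \<alpha> - 4)))"

end

theory Submission
  imports Defs
begin

text \<open>
  Write the exponent in the subordination as \<open>\<omega>(z) = c\<^sub>1 z + c\<^sub>2 z\<^sup>2 + \<dots>\<close>, a Schwarz function.
  Comparing coefficients in \<open>z f'(z) = f(z) exp (\<alpha> \<omega>(z))\<close> gives \<open>a\<^sub>2 = \<alpha> c\<^sub>1\<close> and
  \<open>a\<^sub>3 = \<alpha> c\<^sub>2 / 2 + 3 \<alpha>\<^sup>2 c\<^sub>1\<^sup>2 / 4\<close>. The determinant becomes transparent after completing a square:
  it equals \<open>(1 - |a\<^sub>2|\<^sup>2)\<^sup>2 - |a\<^sub>3 - a\<^sub>2\<^sup>2|\<^sup>2\<close>, where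
  \<open>a\<^sub>3 - a\<^sub>2\<^sup>2 = \<alpha> c\<^sub>2 / 2 - \<alpha>\<^sup>2 c\<^sub>1\<^sup>2 / 4\<close>. Since \<open>|a\<^sub>2| \<le> \<alpha> \<le> 1\<close>, the upper bound is immediate, and
  the identity function attains it.

  The lower bound rests on the Schwarz--Pick coefficient inequality \<open>|c\<^sub>2| \<le> 1 - |c\<^sub>1|\<^sup>2\<close>:
  with \<open>x = |c\<^sub>1|\<^sup>2 \<in> [0, 1]\<close> it bounds the determinant below by the quadratic polynomial
  \<open>(1 - \<alpha>\<^sup>2 x)\<^sup>2 - (\<alpha> (1 - x) / 2 + \<alpha>\<^sup>2 x / 4)\<^sup>2\<close>. Its minimum over \<open>[0, 1]\<close> is at the endpoint \<open>1\<close>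
  or at its vertex, and the vertex enters the interval exactly when \<open>15 \<alpha>\<^sup>2 + 2 \<alpha> \<ge> 16\<close>, that is
  \<open>\<alpha> \<ge> \<alpha>\<^sub>H\<close>. The bound is attained for every \<open>x\<close>, because \<open>\<omega>(z) = z (c - z) / (1 - c z)\<close> with
  \<open>c = \<surd>x\<close> has \<open>c\<^sub>1 = c\<close> and \<open>c\<^sub>2 = - (1 - c\<^sup>2)\<close>, so that both estimates become equalities; and every
  Schwarz function \<open>\<omega>\<close> comes from some \<open>f\<close> by solving the differential equation above.
\<close>

section \<open>The coefficients of a Schwarz function\<close>

lemma has_fps_expansion_on_disc:
  assumes "f holomorphic_on \<D>"
  shows "f has_fps_expansion fps_expansion f 0"
  using assms by (intro has_fps_expansion_fps_expansion[of \<D>]) auto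

lemma taylor_coeff_eqI:
  assumes "f has_fps_expansion F"
  shows "taylor_coeff f n = fps_nth F n"
  using fps_nth_fps_expansion[OF assms] by (simp add: taylor_coeff_def fps_expansion_def)

lemma taylor_coeff_1: "taylor_coeff f (Suc 0) = deriv f 0"
  by (simp add: taylor_coeff_def fps_expansion_def)

text \<open>
  This is the Schwarz--Pick lemma at the origin: a Moebius transformation moves the value
  \<open>\<phi>(0)\<close> to \<open>0\<close>, and the Schwarz lemma bounds the derivative of the composition.
\<close>

lemma Schwarz_Pick_at_0:
  assumes hol: "\<phi> holomorphic_on \<D>" and less1: "\<And>z. z \<in> \<D> \<Longrightarrow> norm (\<phi> z) < 1"
  shows "norm (deriv \<phi> 0) \<le> 1 - (norm (\<phi> 0))\<^sup>2"
proof -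
  define a where "a = \<phi> 0"
  have a: "norm a < 1" using less1[of 0] by (simp add: a_def)
  then have pos: "0 < 1 - (norm a)\<^sup>2"
    by (simp add: power_less_one_iff abs_square_less_1)
  have aa: "1 - cnj a * a = of_real (1 - (norm a)\<^sup>2)"
    using complex_norm_square[of a] by (simp add: mult.commute)
  have "\<phi> ` \<D> \<subseteq> \<D>" using less1 by (simp add: image_subset_iff)
  then have hol': "(\<lambda>z. Moebius_function 0 a (\<phi> z)) holomorphic_on \<D>"
    using holomorphic_on_compose_gen[OF hol Moebius_function_holomorphic[OF a, of 0]]
    by (simp add: o_def)
  have 1: "norm (deriv (\<lambda>z. Moebius_function 0 a (\<phi> z)) 0) \<le> 1"
    by (rule Schwarz_Lemma(2)[OF hol', of 0])
      (use less1 a in \<open>auto simp: Moebius_function_norm_lt_1 a_def Moebius_function_eq_zero\<close>)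
  have d: "(\<phi> has_field_derivative deriv \<phi> 0) (at 0)"
    using hol by (auto intro: holomorphic_derivI)
  have nz: "1 - cnj a * \<phi> 0 \<noteq> 0"
    using aa pos by (simp add: a_def[symmetric] del: of_real_diff)
  have "((\<lambda>z. (\<phi> z - a) / (1 - cnj a * \<phi> z)) has_field_derivative
      ((deriv \<phi> 0 - 0) * (1 - cnj a * \<phi> 0) - (\<phi> 0 - a) * (0 - cnj a * deriv \<phi> 0))
        / ((1 - cnj a * \<phi> 0) * (1 - cnj a * \<phi> 0))) (at 0)"
    by (intro DERIV_divide DERIV_diff DERIV_const DERIV_cmult d nz)
  then have "((\<lambda>z. (\<phi> z - a) / (1 - cnj a * \<phi> z)) has_field_derivative
      deriv \<phi> 0 / (1 - cnj a * a)) (at 0)"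
    using nz by (simp add: a_def)
  then have "deriv (\<lambda>z. Moebius_function 0 a (\<phi> z)) 0 = deriv \<phi> 0 / (1 - cnj a * a)"
    by (simp add: Moebius_function_simple DERIV_imp_deriv)
  also have "norm \<dots> = norm (deriv \<phi> 0) / (1 - (norm a)\<^sup>2)"
    unfolding aa norm_divide norm_of_real using pos by simp
  finally have "norm (deriv \<phi> 0) / (1 - (norm a)\<^sup>2) \<le> 1" using 1 by simp
  then show ?thesis using pos by (simp add: a_def)
qed

text \<open>
  Dividing \<open>\<omega>\<close> by \<open>z\<close> gives a function bounded by \<open>1\<close> with Taylor coefficients \<open>c\<^sub>1\<close>, \<open>c\<^sub>2\<close>, to which
  the preceding lemma applies if the bound is strict. By the equality case of the Schwarz lemma this fails
  only for rotations; these fall under the linear \<open>\<omega>\<close>, for which \<open>c\<^sub>2\<close> vanishes.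
\<close>

lemma Schwarz_function_second_coeff:
  assumes hol: "\<omega> holomorphic_on \<D>" and 0: "\<omega> 0 = 0" and maps: "\<omega> ` \<D> \<subseteq> \<D>"
  shows "norm (taylor_coeff \<omega> 1) \<le> 1"
    and "norm (taylor_coeff \<omega> 2) \<le> 1 - (norm (taylor_coeff \<omega> 1))\<^sup>2"
proof -
  have lt: "\<And>z. norm z < 1 \<Longrightarrow> norm (\<omega> z) < 1" using maps by (simp add: image_subset_iff)
  note Schwarz = Schwarz_Lemma[OF hol 0 lt]
  show c1: "norm (taylor_coeff \<omega> 1) \<le> 1"
    using Schwarz(2)[of 0] by (simp add: taylor_coeff_1)
  show "norm (taylor_coeff \<omega> 2) \<le> 1 - (norm (taylor_coeff \<omega> 1))\<^sup>2"
  proof (cases "\<exists>c. \<forall>z. norm z < 1 \<longrightarrow> \<omega> z = c * z")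
    case True
    then obtain c where c: "\<And>z. norm z < 1 \<Longrightarrow> \<omega> z = c * z" by blast
    have "\<forall>\<^sub>F z in nhds 0. z \<in> \<D>" by (rule eventually_nhds_in_open) auto
    then have ev: "\<forall>\<^sub>F z in nhds 0. \<omega> z = c * z"
      by eventually_elim (use c in auto)
    have "(\<lambda>z. c * z) has_fps_expansion fps_const c * fps_X"
      by (intro fps_expansion_intros)
    then have "\<omega> has_fps_expansion fps_const c * fps_X"
      using has_fps_expansion_cong[OF ev refl] by simp
    then have "taylor_coeff \<omega> 2 = 0" by (simp add: taylor_coeff_eqI)
    then show ?thesis using c1 by (simp add: power_le_one)
  next
    case False
    obtain \<phi> where \<phi>: "\<phi> holomorphic_on \<D>" "\<And>z. norm z < 1 \<Longrightarrow> \<omega> z = z * \<phi> z"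
      "deriv \<omega> 0 = \<phi> 0"
        using Schwarz3[OF hol 0] by blast
    have less1: "norm (\<phi> z) < 1" if "z \<in> \<D>" for z
    proof (cases "z = 0")
      case True
      have "norm (deriv \<omega> 0) \<noteq> 1" using Schwarz(3)[of 0] False by auto
      then show ?thesis using Schwarz(2)[of 0] \<phi>(3) True by simp
    next
      case nz: False
      have "norm (\<omega> z) \<noteq> norm z" using Schwarz(3)[of z] False that nz by auto
      then have "norm (\<omega> z) < norm z" using Schwarz(1)[of z] that by simp
      then show ?thesis using \<phi>(2)[of z] that nz by (simp add: norm_mult)
    qed
    have "\<forall>\<^sub>F z in nhds 0. z \<in> \<D>" by (rule eventually_nhds_in_open) auto
    then have ev: "\<forall>\<^sub>F z in nhds 0. \<omega> z = z * \<phi> z"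
      by eventually_elim (use \<phi>(2) in auto)
    have "(\<lambda>z. z * \<phi> z) has_fps_expansion fps_X * fps_expansion \<phi> 0"
      by (intro fps_expansion_intros has_fps_expansion_on_disc \<phi>)
    then have "\<omega> has_fps_expansion fps_X * fps_expansion \<phi> 0"
      using has_fps_expansion_cong[OF ev refl] by simp
    then have "taylor_coeff \<omega> 2 = deriv \<phi> 0"
      by (simp add: taylor_coeff_eqI fps_expansion_def)
    then show ?thesis
      using Schwarz_Pick_at_0[OF \<phi>(1) less1] \<phi>(3) by (simp add: taylor_coeff_1)
  qed
qed

section \<open>The class and its Schwarz functions\<close>

text \<open>
  The differential equation is read as an identity of formal power series,
  \<open>X F' = F (exp (\<alpha> X) \<circ> W)\<close>, and solved for the coefficients of \<open>F\<close> one after the other.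
\<close>

lemma coeffs_of_exponential_starlike:
  assumes f: "f holomorphic_on \<D>" "f 0 = 0" "deriv f 0 = 1"
    and w: "\<omega> holomorphic_on \<D>" "\<omega> 0 = 0"
    and ode: "\<And>z. z \<in> \<D> \<Longrightarrow> z * deriv f z = f z * exp (of_real \<alpha> * \<omega> z)"
  shows "taylor_coeff f 2 = of_real \<alpha> * taylor_coeff \<omega> 1"
    and "taylor_coeff f 3 = of_real \<alpha> * taylor_coeff \<omega> 2 / 2
      + 3 * (of_real \<alpha>)\<^sup>2 * (taylor_coeff \<omega> 1)\<^sup>2 / 4"
proof -
  define F where "F = fps_expansion f 0"
  define W where "W = fps_expansion \<omega> 0"
  define P where "P = fps_exp (complex_of_real \<alpha>) oo W"
  have F: "f has_fps_expansion F" and W: "\<omega> has_fps_expansion W"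
    using f(1) w(1) by (simp_all add: F_def W_def has_fps_expansion_on_disc)
  have W0: "fps_nth W 0 = 0" using w(2) by (simp add: W_def fps_expansion_def)
  have F01: "fps_nth F 0 = 0" "fps_nth F 1 = 1"
    using f(2,3) by (simp_all add: F_def fps_expansion_def)
  have "((\<lambda>z. exp (of_real \<alpha> * z)) \<circ> \<omega>) has_fps_expansion P"
    unfolding P_def by (intro has_fps_expansion_compose has_fps_expansion_exp W W0)
  then have "(\<lambda>z. f z * exp (of_real \<alpha> * \<omega> z)) has_fps_expansion F * P"
    using has_fps_expansion_mult[OF F] by (simp add: o_def)
  moreover have "\<forall>\<^sub>F z in nhds 0. z \<in> \<D>" by (rule eventually_nhds_in_open) auto
  then have "\<forall>\<^sub>F z in nhds 0. z * deriv f z = f z * exp (of_real \<alpha> * \<omega> z)"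
    by eventually_elim (rule ode)
  ultimately have "(\<lambda>z. z * deriv f z) has_fps_expansion F * P"
    using has_fps_expansion_cong[OF _ refl] by metis
  moreover have "(\<lambda>z. z * deriv f z) has_fps_expansion fps_X * fps_deriv F"
    by (intro fps_expansion_intros F)
  ultimately have eq: "fps_X * fps_deriv F = F * P"
    by (rule fps_expansion_unique_complex[rotated])
  have P: "fps_nth P 0 = 1" "fps_nth P 1 = of_real \<alpha> * fps_nth W 1"
    "fps_nth P 2 = of_real \<alpha> * fps_nth W 2 + (of_real \<alpha>)\<^sup>2 * (fps_nth W 1)\<^sup>2 / 2"
    using W0 by (simp_all add: P_def fps_compose_nth fps_mult_nth eval_nat_numeral)
  have "2 * fps_nth F 2 = fps_nth F 2 + fps_nth P 1"
    using arg_cong[OF eq, of "\<lambda>G. fps_nth G 2"] F01 P(1)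
    by (simp add: fps_mult_nth[of F] eval_nat_numeral)
  then have F2: "fps_nth F 2 = fps_nth P 1" by simp
  have "3 * fps_nth F 3 = fps_nth F 3 + fps_nth F 2 * fps_nth P 1 + fps_nth P 2"
    using arg_cong[OF eq, of "\<lambda>G. fps_nth G 3"] F01 P(1)
    by (simp add: fps_mult_nth[of F] eval_nat_numeral)
  then have F3: "fps_nth F 3 = ((fps_nth P 1)\<^sup>2 + fps_nth P 2) / 2"
    using F2 by (simp add: power2_eq_square eq_divide_eq mult.commute)
  show "taylor_coeff f 2 = of_real \<alpha> * taylor_coeff \<omega> 1"
    using F2 P(2) by (simp add: taylor_coeff_def F_def W_def)
  show "taylor_coeff f 3 = of_real \<alpha> * taylor_coeff \<omega> 2 / 2
      + 3 * (of_real \<alpha>)\<^sup>2 * (taylor_coeff \<omega> 1)\<^sup>2 / 4"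
    using F3 P(2,3) by (simp add: taylor_coeff_def F_def W_def field_simps power2_eq_square)
qed

lemma S_ex_cases:
  assumes "f \<in> S_ex \<alpha>"
  obtains \<omega> where "\<omega> holomorphic_on \<D>" "\<omega> 0 = 0" "\<omega> ` \<D> \<subseteq> \<D>"
    "taylor_coeff f 2 = of_real \<alpha> * taylor_coeff \<omega> 1"
    "taylor_coeff f 3 = of_real \<alpha> * taylor_coeff \<omega> 2 / 2
      + 3 * (of_real \<alpha>)\<^sup>2 * (taylor_coeff \<omega> 1)\<^sup>2 / 4"
proof -
  have f: "f holomorphic_on \<D>" "f 0 = 0" "deriv f 0 = 1"
    using assms by (auto simp: S_ex_def class_A_iff)
  obtain \<omega> where w: "\<omega> holomorphic_on \<D>" "\<omega> ` \<D> \<subseteq> \<D>" "\<omega> 0 = 0"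
    "\<And>z. z \<in> \<D> \<Longrightarrow> (if z = 0 then 1 else z * deriv f z / f z) = exp (of_real \<alpha> * \<omega> z)"
    using assms unfolding S_ex_def subordinate_def by blast
  have "z * deriv f z = f z * exp (of_real \<alpha> * \<omega> z)" if "z \<in> \<D>" for z
  proof (cases "z = 0")
    case True
    then show ?thesis using f(2) by simp
  next
    case False
    then have q: "z * deriv f z / f z = exp (of_real \<alpha> * \<omega> z)" using w(4)[OF that] by simp
    then have "f z \<noteq> 0" by (metis div_by_0 exp_not_eq_zero)
    then show ?thesis using q by (simp add: field_simps)
  qed
  from that[OF w(1,3,2) coeffs_of_exponential_starlike[OF f w(1,3) this]] show thesis by blast
qed

text \<open>
  Conversely, \<open>f(z) = z exp (\<integral>\<^sub>0\<^sup>z (exp (\<alpha> \<omega>(t)) - 1) / t dt)\<close> solves the differential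
  equation for any given \<open>\<omega>\<close>; the integrand has a removable singularity at the origin, and the disc is convex.
\<close>

lemma S_ex_exists:
  assumes w: "\<omega> holomorphic_on \<D>" "\<omega> 0 = 0" "\<omega> ` \<D> \<subseteq> \<D>"
  obtains f where "f \<in> S_ex \<alpha>"
    "taylor_coeff f 2 = of_real \<alpha> * taylor_coeff \<omega> 1"
    "taylor_coeff f 3 = of_real \<alpha> * taylor_coeff \<omega> 2 / 2
      + 3 * (of_real \<alpha>)\<^sup>2 * (taylor_coeff \<omega> 1)\<^sup>2 / 4"
proof -
  define E where "E z = exp (of_real \<alpha> * \<omega> z)" for z
  have E: "E holomorphic_on \<D>" unfolding E_def by (intro holomorphic_intros w)
  have "(\<lambda>z. E z - 1) holomorphic_on \<D>" by (intro holomorphic_intros E)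
  moreover have "E 0 - 1 = 0" using w(2) by (simp add: E_def)
  ultimately obtain h where h: "h holomorphic_on \<D>" "\<And>z. norm z < 1 \<Longrightarrow> E z - 1 = z * h z"
    by (rule Schwarz3) blast
  obtain H where H0: "\<And>z. z \<in> \<D> \<Longrightarrow> (H has_field_derivative h z) (at z within \<D>)"
    using holomorphic_convex_primitive'[OF _ _ h(1)] by auto
  then have H: "(H has_field_derivative h z) (at z)" if "z \<in> \<D>" for z
    using H0[OF that] at_within_open[OF that open_ball] by simp
  \<comment> \<open>Subtracting the value at the origin makes the derivative of the solution there equal to one.\<close>
  define f where "f z = z * exp (H z - H 0)" for z
  have fd: "(f has_field_derivative exp (H z - H 0) * E z) (at z)" if "z \<in> \<D>" for z
  proof -
    have "E z = 1 + z * h z" using h(2)[of z] that by (simp add: algebra_simps)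
    then show ?thesis unfolding f_def
      by (auto intro!: derivative_eq_intros H that simp: algebra_simps)
  qed
  then have df: "deriv f z = exp (H z - H 0) * E z" if "z \<in> \<D>" for z
    using that by (intro DERIV_imp_deriv) auto
  have f: "f holomorphic_on \<D>" "f 0 = 0" "deriv f 0 = 1"
  proof -
    show "f holomorphic_on \<D>" using fd holomorphic_on_open[OF open_ball] by blast
    show "f 0 = 0" by (simp add: f_def)
    show "deriv f 0 = 1" using df[of 0] w(2) by (simp add: E_def)
  qed
  have "(if z = 0 then 1 else z * deriv f z / f z) = E z" if "z \<in> \<D>" for z
    using that df[OF that] w(2) by (auto simp: f_def E_def)
  then have "(\<lambda>z. if z = 0 then 1 else z * deriv f z / f z) \<prec>\<^sub>s (\<lambda>z. exp (of_real \<alpha> * z))"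
    unfolding subordinate_def
    by (intro conjI exI[of _ \<omega>] ballI holomorphic_intros w holomorphic_transform[OF E])
      (auto simp: E_def)
  then have "f \<in> S_ex \<alpha>" using f by (simp add: S_ex_def class_A_iff)
  moreover have ode: "z * deriv f z = f z * exp (of_real \<alpha> * \<omega> z)" if "z \<in> \<D>" for z
    using df[OF that] by (simp add: f_def E_def)
  ultimately show thesis
    using that coeffs_of_exponential_starlike[OF f w(1,2) ode] by blast
qed

text \<open>
  This is \<open>z\<close> times a disc automorphism, or the identity when \<open>c = 1\<close>, with equality in the
  Schwarz--Pick coefficient inequality. Its second coefficient is not positive, so that the two terms of
  \<open>a\<^sub>3 - a\<^sub>2\<^sup>2 = \<alpha> c\<^sub>2 / 2 - \<alpha>\<^sup>2 c\<^sub>1\<^sup>2 / 4\<close> have the same sign and the triangle inequality is sharp too.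
\<close>

lemma extremal_Schwarz_function:
  assumes c: "0 \<le> c" "c \<le> (1::real)"
  defines "\<omega> \<equiv> \<lambda>z. z * ((of_real c - z) / (1 - of_real c * z))"
  shows "\<omega> holomorphic_on \<D>" "\<omega> 0 = 0" "\<omega> ` \<D> \<subseteq> \<D>"
    and "taylor_coeff \<omega> 1 = of_real c" "taylor_coeff \<omega> 2 = - of_real (1 - c\<^sup>2)"
proof -
  have nz: "1 - of_real c * z \<noteq> 0" if "z \<in> \<D>" for z
  proof -
    have "norm (of_real c * z) < 1"
      using that c mult_mono[of c 1 "norm z" "norm z"] by (auto simp: norm_mult)
    then show ?thesis by (metis eq_iff_diff_eq_0 less_irrefl norm_one)
  qed
  show hol: "\<omega> holomorphic_on \<D>"
    unfolding \<omega>_def by (intro holomorphic_intros nz)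
  show 0: "\<omega> 0 = 0" by (simp add: \<omega>_def)
  have "norm (\<omega> z) < 1" if "z \<in> \<D>" for z
  proof -
    have "(norm (1 - of_real c * z))\<^sup>2 - (norm (of_real c - z))\<^sup>2 = (1 - c\<^sup>2) * (1 - (norm z)\<^sup>2)"
      unfolding cmod_power2 by (simp add: power2_eq_square algebra_simps)
    moreover have "0 \<le> (1 - c\<^sup>2) * (1 - (norm z)\<^sup>2)"
      using that c by (intro mult_nonneg_nonneg) (auto simp: power_le_one)
    ultimately have "(norm (of_real c - z))\<^sup>2 \<le> (norm (1 - of_real c * z))\<^sup>2" by linarith
    then have "norm (of_real c - z) \<le> norm (1 - of_real c * z)"
      by (rule power2_le_imp_le) simp
    then have "norm ((of_real c - z) / (1 - of_real c * z)) \<le> 1"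
      using nz[OF that] by (simp add: norm_divide divide_simps)
    then have "norm (\<omega> z) \<le> norm z * 1"
      unfolding \<omega>_def norm_mult by (intro mult_left_mono) auto
    then show ?thesis using that by simp
  qed
  then show "\<omega> ` \<D> \<subseteq> \<D>" by auto
  define W where "W = fps_expansion \<omega> 0"
  have W: "\<omega> has_fps_expansion W" using hol by (simp add: W_def has_fps_expansion_on_disc)
  have "\<forall>\<^sub>F z in nhds 0. z \<in> \<D>" by (rule eventually_nhds_in_open) auto
  then have "\<forall>\<^sub>F z in nhds 0. \<omega> z * (1 - of_real c * z) = z * (of_real c - z)"
    by eventually_elim (use nz in \<open>simp add: \<omega>_def\<close>)
  moreover have "(\<lambda>z. \<omega> z * (1 - of_real c * z)) has_fps_expansion W * (1 - fps_const (of_real c) * fps_X)"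
    by (intro fps_expansion_intros W)
  ultimately have "(\<lambda>z. z * (of_real c - z)) has_fps_expansion W * (1 - fps_const (of_real c) * fps_X)"
    using has_fps_expansion_cong[OF _ refl] by metis
  moreover have "(\<lambda>z. z * (complex_of_real c - z)) has_fps_expansion
      fps_X * (fps_const (of_real c) - fps_X)"
    by (intro fps_expansion_intros)
  ultimately have eq: "W * (1 - fps_const (of_real c) * fps_X) = fps_X * (fps_const (of_real c) - fps_X)"
    by (rule fps_expansion_unique_complex)
  have W0: "fps_nth W 0 = 0" using 0 by (simp add: W_def fps_expansion_def)
  have W1: "fps_nth W 1 = of_real c"
    using arg_cong[OF eq, of "\<lambda>G. fps_nth G 1"] W0 by (simp add: fps_mult_nth[of W])
  moreover have "fps_nth W 2 = - of_real (1 - c\<^sup>2)"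
    using arg_cong[OF eq, of "\<lambda>G. fps_nth G 2"] W0 W1
    by (simp add: fps_mult_nth[of W] eval_nat_numeral algebra_simps)
  ultimately show "taylor_coeff \<omega> 1 = of_real c" "taylor_coeff \<omega> 2 = - of_real (1 - c\<^sup>2)"
    by (simp_all add: taylor_coeff_def W_def)
qed

section \<open>The determinant and its extreme values\<close>

lemma T_3_1_eq_diff_squares:
  "T_3_1 f = (1 - (norm (taylor_coeff f 2))\<^sup>2)\<^sup>2
     - (norm (taylor_coeff f 3 - (taylor_coeff f 2)\<^sup>2))\<^sup>2"
  unfolding T_3_1_eq cmod_power2 by (simp add: power2_eq_square algebra_simps)

text \<open>The lower bound for the determinant, as a function of \<open>x = |c\<^sub>1|\<^sup>2\<close>.\<close>

definition lower_poly :: "real \<Rightarrow> real \<Rightarrow> real" where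
  "lower_poly \<alpha> x = (1 - \<alpha>\<^sup>2 * x)\<^sup>2 - (\<alpha> * (1 - x) / 2 + \<alpha>\<^sup>2 * x / 4)\<^sup>2"

lemma lower_poly_1: "lower_poly \<alpha> 1 = 1 - 2 * \<alpha>\<^sup>2 + 15 * \<alpha> ^ 4 / 16"
  by (simp add: lower_poly_def power2_eq_square power4_eq_xxxx field_simps)

lemma alpha_H_le_iff:
  assumes "0 < \<alpha>"
  shows "alpha_H \<le> \<alpha> \<longleftrightarrow> 16 \<le> 15 * \<alpha>\<^sup>2 + 2 * \<alpha>"
proof -
  have "alpha_H \<le> \<alpha> \<longleftrightarrow> sqrt 241 \<le> 15 * \<alpha> + 1" by (auto simp: alpha_H_def field_simps)
  also have "\<dots> \<longleftrightarrow> 241 \<le> (15 * \<alpha> + 1)\<^sup>2"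
    using assms real_le_rsqrt real_sqrt_le_iff[of 241 "(15 * \<alpha> + 1)\<^sup>2"] by simp
  also have "\<dots> \<longleftrightarrow> 16 \<le> 15 * \<alpha>\<^sup>2 + 2 * \<alpha>"
  proof -
    have "(15 * \<alpha> + 1)\<^sup>2 = 15 * (15 * \<alpha>\<^sup>2 + 2 * \<alpha>) + 1"
      by (simp add: power2_eq_square algebra_simps)
    then show ?thesis by auto
  qed
  finally show ?thesis .
qed

text \<open>Below \<open>\<alpha>\<^sub>H\<close> the polynomial decreases on the unit interval, because its derivative, which
  is affine in \<open>x\<close>, is negative at both ends. The proof splits \<open>1 - x\<close> off the difference to the value
  at \<open>1\<close> and bounds the cofactor, which is affine as well.\<close>

lemma lower_poly_below:
  assumes a: "0 < \<alpha>" "15 * \<alpha>\<^sup>2 + 2 * \<alpha> < 16" and x: "0 \<le> x" "x \<le> 1"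
  shows "lower_poly \<alpha> 1 \<le> lower_poly \<alpha> x"
proof -
  define K where "K = 15 * \<alpha>\<^sup>2 + 4 * \<alpha> - 4"
  have "lower_poly \<alpha> x - lower_poly \<alpha> 1 = \<alpha>\<^sup>2 / 16 * (1 - x) * (4 * (\<alpha> + 6) - K * (1 + x))"
    by (simp add: lower_poly_def K_def power2_eq_square field_simps)
  moreover have "K * (1 + x) \<le> 4 * (\<alpha> + 6)"
  proof (cases "K \<le> 0")
    case True
    then have "K * (1 + x) \<le> 0" using x by (simp add: mult_nonpos_nonneg)
    then show ?thesis using a by simp
  next
    case False
    then have "K * (1 + x) \<le> K * 2" using x by (intro mult_left_mono) auto
    then show ?thesis using a by (simp add: K_def)
  qed
  ultimately show ?thesis using x by (smt (verit) divide_nonneg_pos mult_nonneg_nonneg zero_le_power2)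
qed

text \<open>Completing the square exhibits the vertex, at \<open>2 (\<alpha> + 6) / (15 \<alpha>\<^sup>2 + 4 \<alpha> - 4)\<close>.\<close>

lemma lower_poly_vertex:
  assumes "0 < 15 * \<alpha>\<^sup>2 + 4 * \<alpha> - 4"
  shows "lower_poly \<alpha> x = 1 - \<alpha>\<^sup>2 / 4 - \<alpha>\<^sup>2 * (\<alpha> + 6)\<^sup>2 / (4 * (15 * \<alpha>\<^sup>2 + 4 * \<alpha> - 4))
    + \<alpha>\<^sup>2 / 16 * (15 * \<alpha>\<^sup>2 + 4 * \<alpha> - 4) * (x - 2 * (\<alpha> + 6) / (15 * \<alpha>\<^sup>2 + 4 * \<alpha> - 4))\<^sup>2"
proof -
  define K where "K = 15 * \<alpha>\<^sup>2 + 4 * \<alpha> - 4"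
  have K: "K \<noteq> 0" using assms by (simp add: K_def)
  have "lower_poly \<alpha> x = 1 - \<alpha>\<^sup>2 / 4 + \<alpha>\<^sup>2 / 16 * (K * x\<^sup>2 - 4 * (\<alpha> + 6) * x)"
    by (simp add: lower_poly_def K_def power2_eq_square field_simps)
  also have "K * x\<^sup>2 - 4 * (\<alpha> + 6) * x = K * (x - 2 * (\<alpha> + 6) / K)\<^sup>2 - 4 * (\<alpha> + 6)\<^sup>2 / K"
    using K by (simp add: power2_eq_square field_simps)
  also have "1 - \<alpha>\<^sup>2 / 4 + \<alpha>\<^sup>2 / 16 * \<dots> = 1 - \<alpha>\<^sup>2 / 4 - \<alpha>\<^sup>2 * (\<alpha> + 6)\<^sup>2 / (4 * K)
      + \<alpha>\<^sup>2 / 16 * K * (x - 2 * (\<alpha> + 6) / K)\<^sup>2"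
    by (simp add: algebra_simps)
  finally show ?thesis by (simp add: K_def)
qed

lemma B_L_is_minimum:
  assumes a: "0 < \<alpha>" "\<alpha> \<le> 1"
  shows "\<forall>x\<in>{0..1}. B_L \<alpha> \<le> lower_poly \<alpha> x" and "\<exists>x\<in>{0..1}. lower_poly \<alpha> x = B_L \<alpha>"
proof -
  have "(\<forall>x\<in>{0..1}. B_L \<alpha> \<le> lower_poly \<alpha> x) \<and> (\<exists>x\<in>{0..1}. lower_poly \<alpha> x = B_L \<alpha>)"
  proof (cases "\<alpha> < alpha_H")
    case True
    then have "15 * \<alpha>\<^sup>2 + 2 * \<alpha> < 16" using alpha_H_le_iff[OF a(1)] by simp
    moreover have "B_L \<alpha> = lower_poly \<alpha> 1" using True by (simp add: B_L_def lower_poly_1)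
    ultimately show ?thesis using lower_poly_below[OF a(1)] by (auto intro!: bexI[of _ 1])
  next
    case False
    define K where "K = 15 * \<alpha>\<^sup>2 + 4 * \<alpha> - 4"
    have K: "2 * (\<alpha> + 6) \<le> K" using False alpha_H_le_iff[OF a(1)] by (simp add: K_def)
    then have Kpos: "0 < K" using a by simp
    have eq: "lower_poly \<alpha> x = B_L \<alpha> + \<alpha>\<^sup>2 / 16 * K * (x - 2 * (\<alpha> + 6) / K)\<^sup>2" for x
      using lower_poly_vertex[of \<alpha> x] Kpos False by (simp add: B_L_def K_def)
    have "2 * (\<alpha> + 6) / K \<in> {0..1}" using K Kpos a by (simp add: divide_simps)
    then show ?thesis using Kpos by (auto simp: eq intro!: bexI[of _ "2 * (\<alpha> + 6) / K"])
  qed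
  then show "\<forall>x\<in>{0..1}. B_L \<alpha> \<le> lower_poly \<alpha> x" and "\<exists>x\<in>{0..1}. lower_poly \<alpha> x = B_L \<alpha>"
    by blast+
qed

text \<open>Both bounds come from the difference of squares: dropping the subtracted square gives the upper
  one, and the triangle inequality with Schwarz--Pick gives the lower one.\<close>

lemma T_3_1_bounds:
  assumes a: "0 < \<alpha>" "\<alpha> \<le> 1" and f: "f \<in> S_ex \<alpha>"
  shows "B_L \<alpha> \<le> T_3_1 f" and "T_3_1 f \<le> 1"
proof -
  obtain \<omega> where w: "\<omega> holomorphic_on \<D>" "\<omega> 0 = 0" "\<omega> ` \<D> \<subseteq> \<D>"
    and a2: "taylor_coeff f 2 = of_real \<alpha> * taylor_coeff \<omega> 1"
    and a3: "taylor_coeff f 3 = of_real \<alpha> * taylor_coeff \<omega> 2 / 2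
      + 3 * (of_real \<alpha>)\<^sup>2 * (taylor_coeff \<omega> 1)\<^sup>2 / 4"
    by (rule S_ex_cases[OF f])
  define c1 where "c1 = taylor_coeff \<omega> 1"
  define c2 where "c2 = taylor_coeff \<omega> 2"
  define x where "x = (norm c1)\<^sup>2"
  have c: "norm c1 \<le> 1" "norm c2 \<le> 1 - x"
    using Schwarz_function_second_coeff[OF w(1,2,3)] by (simp_all add: c1_def c2_def x_def)
  then have x: "0 \<le> x" "x \<le> 1" by (simp_all add: x_def power_le_one)
  have n2: "(norm (taylor_coeff f 2))\<^sup>2 = \<alpha>\<^sup>2 * x"
    by (simp add: a2 norm_mult power_mult_distrib c1_def x_def)
  have "taylor_coeff f 3 - (taylor_coeff f 2)\<^sup>2
      = of_real \<alpha> * c2 / 2 - (of_real \<alpha>)\<^sup>2 * c1\<^sup>2 / 4"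
    by (simp add: a2 a3 c1_def c2_def power2_eq_square field_simps)
  also have "norm \<dots> \<le> norm (of_real \<alpha> * c2 / 2) + norm ((of_real \<alpha>)\<^sup>2 * c1\<^sup>2 / 4)"
    by (rule norm_triangle_ineq4)
  also have "\<dots> = \<alpha> * norm c2 / 2 + \<alpha>\<^sup>2 * x / 4"
    using a by (simp add: norm_mult norm_divide norm_power x_def)
  also have "\<dots> \<le> \<alpha> * (1 - x) / 2 + \<alpha>\<^sup>2 * x / 4"
    using c(2) a by simp
  finally have "(norm (taylor_coeff f 3 - (taylor_coeff f 2)\<^sup>2))\<^sup>2
      \<le> (\<alpha> * (1 - x) / 2 + \<alpha>\<^sup>2 * x / 4)\<^sup>2"
    by (rule power_mono) simp
  then have "lower_poly \<alpha> x \<le> T_3_1 f"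
    by (simp add: T_3_1_eq_diff_squares n2 lower_poly_def)
  moreover have "B_L \<alpha> \<le> lower_poly \<alpha> x" using B_L_is_minimum(1)[OF a] x by simp
  ultimately show "B_L \<alpha> \<le> T_3_1 f" by simp
  have "\<alpha>\<^sup>2 * x \<le> 1" using a x by (simp add: mult_le_one power_le_one)
  moreover have "0 \<le> \<alpha>\<^sup>2 * x" using x by simp
  ultimately have "(1 - \<alpha>\<^sup>2 * x)\<^sup>2 \<le> 1" by (intro power_le_one) auto
  then show "T_3_1 f \<le> 1"
    unfolding T_3_1_eq_diff_squares n2 by (smt (verit) zero_le_power2)
qed

lemma lower_poly_attained:
  assumes a: "0 < \<alpha>" and x: "0 \<le> x" "x \<le> 1"
  shows "\<exists>f\<in>S_ex \<alpha>. T_3_1 f = lower_poly \<alpha> x"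
proof -
  define c where "c = sqrt x"
  have c: "0 \<le> c" "c \<le> 1" "c\<^sup>2 = x" using x by (simp_all add: c_def)
  note w = extremal_Schwarz_function[OF c(1,2)]
  obtain f where f: "f \<in> S_ex \<alpha>" "taylor_coeff f 2 = of_real (\<alpha> * c)"
    "taylor_coeff f 3 = of_real \<alpha> * - of_real (1 - c\<^sup>2) / 2 + 3 * (of_real \<alpha>)\<^sup>2 * (of_real c)\<^sup>2 / 4"
    using S_ex_exists[OF w(1-3), of \<alpha>] unfolding w(4,5) by auto
  have f23: "taylor_coeff f 3 - (taylor_coeff f 2)\<^sup>2
      = of_real (- (\<alpha> * (1 - x) / 2 + \<alpha>\<^sup>2 * x / 4))"
    by (simp add: f c(3)[symmetric] power2_eq_square field_simps)
  have "(norm (taylor_coeff f 3 - (taylor_coeff f 2)\<^sup>2))\<^sup>2 = (\<alpha> * (1 - x) / 2 + \<alpha>\<^sup>2 * x / 4)\<^sup>2"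
    unfolding f23 norm_of_real power2_abs by (rule power2_minus)
  moreover have "(norm (taylor_coeff f 2))\<^sup>2 = \<alpha>\<^sup>2 * x"
    unfolding f(2) norm_of_real power2_abs by (simp add: power_mult_distrib c(3))
  ultimately have "T_3_1 f = lower_poly \<alpha> x"
    by (simp add: T_3_1_eq_diff_squares lower_poly_def)
  then show ?thesis using f(1) by blast
qed

lemma T_3_1_1_attained: "\<exists>f\<in>S_ex \<alpha>. T_3_1 f = 1"
proof -
  have w: "(\<lambda>z. 0::complex) holomorphic_on \<D>" "(\<lambda>z. 0::complex) ` \<D> \<subseteq> \<D>" by auto
  have "taylor_coeff (\<lambda>z. 0) n = 0" for n
    using taylor_coeff_eqI[OF has_fps_expansion_0] by simp
  then obtain f where "f \<in> S_ex \<alpha>" "taylor_coeff f 2 = 0" "taylor_coeff f 3 = 0"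
    using S_ex_exists[OF w(1) refl w(2), of \<alpha>] by auto
  then show ?thesis by (intro bexI[of _ f]) (simp_all add: T_3_1_eq)
qed

theorem theorem6p1:
  fixes \<alpha> :: real
  assumes "0 < \<alpha>" and "\<alpha> \<le> 1"
  shows "(\<forall>f \<in> S_ex \<alpha>. B_L \<alpha> \<le> T_3_1 f \<and> T_3_1 f \<le> 1)
       \<and> (\<exists>f \<in> S_ex \<alpha>. T_3_1 f = B_L \<alpha>)
       \<and> (\<exists>f \<in> S_ex \<alpha>. T_3_1 f = 1)"
proof (intro conjI ballI)
  obtain x where "x \<in> {0..1}" "lower_poly \<alpha> x = B_L \<alpha>"
    using B_L_is_minimum(2)[OF assms] by blast
  then show "\<exists>f \<in> S_ex \<alpha>. T_3_1 f = B_L \<alpha>"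
    using lower_poly_attained[OF assms(1), of x] by auto
qed (use T_3_1_bounds[OF assms] T_3_1_1_attained in auto)

end
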